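(* Let $n,m\ge 1$ be integers and, for $z\in\mathbb{C}$, let $$W(-n,m\,|\,z):=\frac{1}{2\pi i}\oint_{O}\frac{e^{\xi+z\xi^{n}}}{\xi^{m}}\,d\xi .$$ Then $W(-n,m\,|\,z)$ is a polynomial in $z$, and $$ W(-n,m\,|\,z)=\frac{1}{\Gamma(m)}\,B_{m-1}\left(g'(0),\,g''(0),\ldots,g^{(m-1)}(0)\right), $$ where $g(\xi)=\xi+z\,\xi^{n}$, derivatives are taken with respect to $\xi$, and $B_{m-1}$ is the $(m-1)$-th complete exponential Bell polynomial.
   Context: The contour integral is taken over a simple closed positively oriented contour surrounding the origin. It extends the Wright function $W(a,b\,|\,z)$ to the parameters $a=-n$, $b=m$ via the integral representation $W(a,b\,|\,z)=\frac{1}{2\pi i}\int e^{\xi+z\xi^{-a}}\xi^{-b}\,d\xi$. The complete exponential Bell polynomials $B_k(x_1,\ldots,x_k)$ are defined by the formal power series identity $$\exp\left(\sum_{j\ge1}x_j\frac{t^j}{j!}\right)=\sum_{k\ge0}B_k(x_1,\ldots,x_k)\frac{t^k}{k!},$$ so that $B_0=1$. *)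

theory Defs
  imports "HOL-Complex_Analysis.Complex_Analysis"
begin

(* A library contour is a piecewise continuously differentiable path; positive orientation
   means that the contour winds exactly once around every point it encloses. *)
definition pos_simple_contour :: "(real \<Rightarrow> complex) \<Rightarrow> bool" where
  "pos_simple_contour \<gamma> \<longleftrightarrow>
     valid_path \<gamma> \<and> simple_path \<gamma> \<and> pathfinish \<gamma> = pathstart \<gamma> \<and>
     0 \<in> inside (path_image \<gamma>) \<and>
     (\<forall>w \<in> inside (path_image \<gamma>). winding_number \<gamma> w = 1)"

lemma pos_simple_contour_circlepath:
  assumes "r > 0"
  shows "pos_simple_contour (circlepath 0 r)"
proof -
  have eq: "path_image (circlepath (0::complex) r) = sphere 0 r"
    using assms by simp
  have ins: "inside (sphere (0::complex) r) = ball 0 r"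
    using inside_frontier_eq_interior[of "cball (0::complex) r"] assms by simp
  show ?thesis
    unfolding pos_simple_contour_def eq ins
    using assms by (auto simp: simple_path_circlepath winding_number_circlepath)
qed

(* The Wright function W(-n, m | z): the argument n stands for the parameter -n. *)
definition wright :: "(real \<Rightarrow> complex) \<Rightarrow> nat \<Rightarrow> nat \<Rightarrow> complex \<Rightarrow> complex" where
  "wright \<gamma> n m z =
     1 / (2 * of_real pi * \<i>) * contour_integral \<gamma> (\<lambda>\<xi>. exp (\<xi> + z * \<xi> ^ n) / \<xi> ^ m)"

(* k! times the coefficient of t^k in exp (sum over j >= 1 of x_j t^j / j!). The arguments
   x_1, ..., x_k are the values at 1, ..., k of a sequence, whose value at 0 is ignored; by
   complete_bell_cong the values beyond k play no role. *)
definition complete_bell :: "nat \<Rightarrow> (nat \<Rightarrow> 'a::field_char_0) \<Rightarrow> 'a" where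
  "complete_bell k x =
     fact k * fps_nth (fps_exp 1 oo Abs_fps (\<lambda>j. if j = 0 then 0 else x j / fact j)) k"

lemma complete_bell_generating_function:
  fixes x :: "nat \<Rightarrow> 'a::field_char_0"
  shows "fps_exp 1 oo Abs_fps (\<lambda>j. if j = 0 then 0 else x j / fact j)
           = Abs_fps (\<lambda>k. complete_bell k x / fact k)"
  by (rule fps_ext) (simp add: complete_bell_def)

lemma complete_bell_0: "complete_bell 0 x = 1"
  by (simp add: complete_bell_def fps_compose_nth)

lemma complete_bell_cong:
  fixes x y :: "nat \<Rightarrow> 'a::field_char_0"
  assumes "\<And>j. 1 \<le> j \<Longrightarrow> j \<le> k \<Longrightarrow> x j = y j"
  shows "complete_bell k x = complete_bell k y"
proof -
  let ?F = "\<lambda>x::nat \<Rightarrow> 'a. Abs_fps (\<lambda>j. if j = 0 then 0 else x j / fact j)"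
  have "fps_nth (?F x ^ i) l = fps_nth (?F y ^ i) l" if "l \<le> k" for i l
    using that
  proof (induction i arbitrary: l)
    case (Suc i)
    then show ?case
      using assms by (auto simp: fps_mult_nth intro!: sum.cong)
  qed simp
  then show ?thesis
    by (simp add: complete_bell_def fps_compose_nth)
qed

end

theory Submission
  imports Defs
begin

text \<open>
  The integrand \<open>exp (g \<xi>) / \<xi> ^ m\<close>, with \<open>g \<xi> = \<xi> + z * \<xi> ^ n\<close>, is holomorphic except for a pole
  at the origin, which the contour encircles once. By the residue theorem the Wright function is
  therefore the Taylor coefficient of order \<open>m - 1\<close> of \<open>exp (g \<xi>)\<close> at the origin
  (\<open>contour_integral_over_power_eq_fps_nth\<close>). Since \<open>n \<ge> 1\<close>, \<open>g\<close> vanishes at the origin, so the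
  Taylor series of \<open>exp (g \<xi>)\<close> is the formal composition of the exponential series with the Taylor
  series of \<open>g\<close>; the coefficients of such a composition are what the complete Bell polynomials of
  the derivatives of \<open>g\<close> record, up to the factorial \<open>(m - 1)! = \<Gamma>(m)\<close>
  (\<open>complete_bell_higher_deriv\<close>).

  That the coefficient is a polynomial in \<open>z\<close> also comes from the composition: only the powers
  \<open>(\<xi> + z * \<xi> ^ n) ^ i\<close> with \<open>i \<le> m - 1\<close> reach order \<open>m - 1\<close>, and the binomial theorem shows that
  each contributes a polynomial in \<open>z\<close> (\<open>fps_nth_exp_compose_poly\<close>). As this polynomial is read off
  from the Taylor coefficient, it is the same for all contours.
\<close>

text \<open>
  Since the numerator is entire, the residue theorem applies in the whole plane with the origin as
  the only singularity, so the origin's winding number, which is 1, is all that the contour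
  contributes.
\<close>
lemma contour_integral_over_power_eq_fps_nth:
  assumes \<gamma>: "pos_simple_contour \<gamma>" and holo: "f holomorphic_on UNIV"
    and F: "f has_fps_expansion F"
  shows "contour_integral \<gamma> (\<lambda>\<xi>. f \<xi> / \<xi> ^ Suc k) = 2 * of_real pi * \<i> * fps_nth F k"
proof -
  have inside: "0 \<in> inside (path_image \<gamma>)"
    using \<gamma> by (simp add: pos_simple_contour_def)
  then have "0 \<notin> path_image \<gamma>"
    using inside_no_overlap[of "path_image \<gamma>"] by blast
  then have "contour_integral \<gamma> (\<lambda>\<xi>. f \<xi> / \<xi> ^ Suc k)
      = of_real (2 * pi) * \<i> *
          (\<Sum>p\<in>{0}. winding_number \<gamma> p * residue (\<lambda>\<xi>. f \<xi> / \<xi> ^ Suc k) p)"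
    using \<gamma> unfolding pos_simple_contour_def
    by (intro Residue_theorem[where S = UNIV])
      (auto intro!: holomorphic_intros holomorphic_on_subset[OF holo])
  then show ?thesis
    using \<gamma> inside residue_fps_expansion_over_power_at_0[OF F, of k]
    by (simp add: pos_simple_contour_def)
qed

text \<open>
  Up to factorials the higher derivatives of \<open>g\<close> are the coefficients of \<open>G\<close>. A complete Bell
  polynomial replaces the constant coefficient by 0, hence the condition on \<open>G\<close>.
\<close>
lemma complete_bell_higher_deriv:
  fixes g :: "complex \<Rightarrow> complex"
  assumes G: "g has_fps_expansion G" and G0: "fps_nth G 0 = 0"
  shows "complete_bell k (\<lambda>j. (deriv ^^ j) g 0) = fact k * fps_nth (fps_exp 1 oo G) k"
proof -
  have "Abs_fps (\<lambda>j. if j = 0 then 0 else (deriv ^^ j) g 0 / fact j) = G"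
    using G0 by (auto simp: fps_eq_iff fps_nth_fps_expansion[OF G])
  then show ?thesis
    by (simp add: complete_bell_def)
qed

text \<open>
  The coefficient of order \<open>k\<close> involves only the powers \<open>i \<le> k\<close> of the inner series. In such a
  power the binomial term with \<open>r\<close> factors \<open>z * X ^ n\<close> has order \<open>n * r + (i - r)\<close>, so the
  coefficient of \<open>z ^ r\<close> is a binomial coefficient or 0.
\<close>
lemma fps_nth_exp_compose_poly:
  "\<exists>p :: 'a :: field_char_0 poly. \<forall>z.
     fps_nth (fps_exp 1 oo (fps_X + fps_const z * fps_X ^ n)) k = poly p z"
proof -
  have pow: "fps_nth ((fps_X + fps_const z * fps_X ^ n) ^ i) k =
      poly (\<Sum>r\<le>i. monom (if k = n * r + (i - r) then of_nat (i choose r) else 0) r) z"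
    for z :: 'a and i
  proof -
    have "(fps_const z * fps_X ^ n + fps_X) ^ i =
        (\<Sum>r\<le>i. fps_const (of_nat (i choose r) * z ^ r) * fps_X ^ (n * r + (i - r)))"
      unfolding binomial_ring
    proof (intro sum.cong refl)
      fix r
      show "of_nat (i choose r) * (fps_const z * fps_X ^ n) ^ r * fps_X ^ (i - r) =
          fps_const (of_nat (i choose r) * z ^ r) * fps_X ^ (n * r + (i - r))"
        unfolding power_mult_distrib fps_const_power power_mult power_add
          fps_const_mult[symmetric] fps_of_nat by (simp only: mult.assoc)
    qed
    then show ?thesis
      by (auto simp: add.commute[of fps_X] fps_sum_nth poly_sum poly_monom intro!: sum.cong)
  qed
  have "fps_nth (fps_exp 1 oo (fps_X + fps_const z * fps_X ^ n)) k =
      poly (\<Sum>i=0..k. smult (1 / fact i)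
        (\<Sum>r\<le>i. monom (if k = n * r + (i - r) then of_nat (i choose r) else 0) r)) z" for z :: 'a
    unfolding fps_compose_nth pow by (simp add: poly_sum)
  then show ?thesis
    by blast
qed

theorem mainTheorem2:
  fixes n m :: nat
  assumes "n \<ge> 1" and "m \<ge> 1"
  shows "(\<exists>p :: complex poly. \<forall>\<gamma> z. pos_simple_contour \<gamma> \<longrightarrow> wright \<gamma> n m z = poly p z) \<and>
         (\<forall>\<gamma> z. pos_simple_contour \<gamma> \<longrightarrow>
            wright \<gamma> n m z =
              1 / Gamma (of_nat m) *
                complete_bell (m - 1) (\<lambda>j. (deriv ^^ j) (\<lambda>\<xi>. \<xi> + z * \<xi> ^ n) 0))"
proof -
  define G :: "complex \<Rightarrow> complex fps" where "G z = fps_X + fps_const z * fps_X ^ n" for z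
  have G: "(\<lambda>\<xi>. \<xi> + z * \<xi> ^ n) has_fps_expansion G z" for z
    unfolding G_def by (intro fps_expansion_intros)
  have G0: "fps_nth (G z) 0 = 0" for z
    using \<open>n \<ge> 1\<close> by (simp add: G_def)
  have m: "m = Suc (m - 1)"
    using \<open>m \<ge> 1\<close> by simp
  have coeff: "wright \<gamma> n m z = fps_nth (fps_exp 1 oo G z) (m - 1)"
    if \<gamma>: "pos_simple_contour \<gamma>" for \<gamma> z
  proof -
    have "(\<lambda>\<xi>. exp (\<xi> + z * \<xi> ^ n)) has_fps_expansion (fps_exp 1 oo G z)"
      using has_fps_expansion_compose[OF has_fps_expansion_exp1 G G0] by (simp add: o_def)
    then have "contour_integral \<gamma> (\<lambda>\<xi>. exp (\<xi> + z * \<xi> ^ n) / \<xi> ^ Suc (m - 1)) =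
        2 * of_real pi * \<i> * fps_nth (fps_exp 1 oo G z) (m - 1)"
      by (intro contour_integral_over_power_eq_fps_nth \<gamma>) (auto intro!: holomorphic_intros)
    then show ?thesis
      unfolding wright_def m[symmetric] by simp
  qed
  have "Gamma (of_nat m) = (fact (m - 1) :: complex)"
    by (subst m) (simp only: of_nat_Suc Gamma_fact)
  then have "wright \<gamma> n m z = 1 / Gamma (of_nat m) *
      complete_bell (m - 1) (\<lambda>j. (deriv ^^ j) (\<lambda>\<xi>. \<xi> + z * \<xi> ^ n) 0)"
    if "pos_simple_contour \<gamma>" for \<gamma> z
    by (simp add: coeff[OF that] complete_bell_higher_deriv[OF G G0])
  moreover have "\<exists>p. \<forall>\<gamma> z. pos_simple_contour \<gamma> \<longrightarrow> wright \<gamma> n m z = poly p z"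
    using fps_nth_exp_compose_poly[of n "m - 1", where 'a = complex] coeff
    unfolding G_def by metis
  ultimately show ?thesis
    by blast
qed

end
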